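(* Let $m\ge2$ and let $w=w_{m-1}\cdots w_0$ be a word over $\{0,1\}$ containing no factor $11$, with $w_0=0$. Let $R_w$ be the increasing sequence of all integers $N\ge0$ with $d_{m-1}(N)\cdots d_0(N)=w$. If $w\ne0^m$, then there is an integer $\gamma_w\le0$ such that $$R_w=V(L_{m-2},L_{m-3},\gamma_w)\ \text{ if } w_{m-1}=0,\qquad R_w=V(L_{m-1},L_{m-2},\gamma_w)\ \text{ if } w_{m-1}=1.$$ For all words consisting only of zeros one has, for $m\ge1$, $$R_{0^{2m}}=V(L_{2m},L_{2m-1},1)\sqcup V_0(L_{2m-1},L_{2m-2},0),\qquad R_{0^{2m+1}}=V_0(L_{2m+1},L_{2m},0)\sqcup V(L_{2m},L_{2m-1},1).$$
   Context: Let $\varphi=(1+\sqrt5)/2$. Every integer $N\ge0$ has a unique base phi expansion $N=\sum_{i\in\mathbb Z} d_i(N)\varphi^i$ with $d_i(N)\in\{0,1\}$, finitely many nonzero, and $d_i(N)d_{i+1}(N)=0$ for all $i$; digits at positions beyond the leading $1$ are $0$ (for $N=0$ all digits are $0$). Lucas numbers: $L_0=2$, $L_1=1$, $L_n=L_{n-1}+L_{n-2}$. For integers $p,q,r$: $V(p,q,r)=(p\lfloor n\varphi\rfloor+qn+r)_{n\ge1}$ and $V_0(p,q,r)=(p\lfloor n\varphi\rfloor+qn+r)_{n\ge0}$. $C\sqcup D$ is the sequence listing the union of the value sets of $C$ and $D$ in increasing order; the union is disjoint. $0^k$ is the word of $k$ zeros. *)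

theory Defs
  imports Complex_Main "HOL-Library.Sublist"
begin

definition phi :: real where
  "phi = (1 + sqrt 5) / 2"

fun lucas :: "nat \<Rightarrow> int" where
  "lucas 0 = 2"
| "lucas (Suc 0) = 1"
| "lucas (Suc (Suc n)) = lucas (Suc n) + lucas n"

text \<open>Two-sided expansions: \<open>d i\<close> is the coefficient of \<open>phi\<close> to the power \<open>i\<close>, for every integer \<open>i\<close>.\<close>

definition is_base_phi_expansion :: "nat \<Rightarrow> (int \<Rightarrow> nat) \<Rightarrow> bool" where
  "is_base_phi_expansion N d \<longleftrightarrow>
     (\<forall>i. d i \<in> {0, 1}) \<and>
     finite {i. d i \<noteq> 0} \<and>
     (\<forall>i. d i * d (i + 1) = 0) \<and>
     real N = (\<Sum>i\<in>{i. d i \<noteq> 0}. real (d i) * phi powi i)"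

definition digit :: "nat \<Rightarrow> int \<Rightarrow> nat" where
  "digit N = (THE d. is_base_phi_expansion N d)"

text \<open>Words are lists in reading order, most significant digit first: a word
  \<open>w\<close> of length \<open>m\<close> has \<open>w\<^sub>m\<^sub>-\<^sub>1 = hd w\<close> and \<open>w\<^sub>0 = last w\<close>.\<close>

definition low_digits :: "nat \<Rightarrow> nat \<Rightarrow> nat list" where
  "low_digits m N = map (\<lambda>i. digit N (int i)) (rev [0..<m])"

definition occurrences :: "nat list \<Rightarrow> nat set" where
  "occurrences w = {N. low_digits (length w) N = w}"

text \<open>Sequences are functions on \<open>nat\<close>, the first term having index 0. A set has at most one
  increasing listing, and has none if it is finite.\<close>

definition increasing_listing :: "int set \<Rightarrow> (nat \<Rightarrow> int) \<Rightarrow> bool" where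
  "increasing_listing A s \<longleftrightarrow> strict_mono s \<and> range s = A"

definition is_R :: "nat list \<Rightarrow> (nat \<Rightarrow> int) \<Rightarrow> bool" where
  "is_R w s \<longleftrightarrow> increasing_listing (int ` occurrences w) s"

definition beatty_term :: "int \<Rightarrow> int \<Rightarrow> int \<Rightarrow> nat \<Rightarrow> int" where
  "beatty_term p q r n = p * \<lfloor>real n * phi\<rfloor> + q * int n + r"

text \<open>\<open>V\<close> starts at \<open>n = 1\<close>, \<open>V0\<close> at \<open>n = 0\<close>.\<close>

definition V :: "int \<Rightarrow> int \<Rightarrow> int \<Rightarrow> nat \<Rightarrow> int" where
  "V p q r = (\<lambda>k. beatty_term p q r (k + 1))"

definition V0 :: "int \<Rightarrow> int \<Rightarrow> int \<Rightarrow> nat \<Rightarrow> int" where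
  "V0 p q r = (\<lambda>k. beatty_term p q r k)"

text \<open>\<open>is_disjoint_union C D s\<close> reads \<open>s = C \<squnion> D\<close>; disjointness of the two value sets
  is part of the assertion.\<close>

definition is_disjoint_union :: "(nat \<Rightarrow> int) \<Rightarrow> (nat \<Rightarrow> int) \<Rightarrow> (nat \<Rightarrow> int) \<Rightarrow> bool" where
  "is_disjoint_union C D s \<longleftrightarrow>
     range C \<inter> range D = {} \<and> increasing_listing (range C \<union> range D) s"

end

theory Submission
  imports Defs "HOL-Library.Infinite_Set"
begin

text \<open>
  Write \<open>psi = 1 - phi\<close> for the conjugate of \<open>phi\<close>. Call \<open>x = a + b phi\<close> with conjugate
  \<open>y = a + b psi\<close> a phi-integer if its expansion uses only positions \<open>\<ge> 0\<close>; this means exactly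
  \<open>x \<ge> 0\<close> and \<open>-1 < y < phi\<close>, and these pairs are indexed by \<open>n = a + 2 b + 1 \<ge> 1\<close>, with
  \<open>b = 2 n - 1 - \<lfloor>n phi\<rfloor>\<close>. Since every nonnegative element of the ring generated by \<open>phi\<close> has a
  finite expansion, a word \<open>w\<close> of length \<open>m\<close> with outermost digits 0 and value \<open>P\<close> occurs exactly in
  the numbers \<open>\<lceil>phi\<^sup>m x + P\<rceil>\<close> for phi-integers \<open>x\<close>. Subtracting the conjugate turns this into
  \<open>a L\<^sub>m + b L\<^sub>m\<^sub>+\<^sub>1 + (P + P') - \<lfloor>P' + psi\<^sup>m y\<rfloor>\<close>. The floor depends only on the parity of the
  lowest nonzero position, hence is constant unless \<open>w\<close> is zero, and the formula for \<open>b\<close> gives the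
  Beatty-type sequence. If \<open>w\<^sub>m\<^sub>-\<^sub>1 = 1\<close> then the next digit is 0 and \<open>w\<close> may be extended by it. If
  \<open>w\<close> is zero, the nonzero phi-integers are split by the sign of \<open>y\<close>.
\<close>

section \<open>The golden ratio and its conjugate\<close>

definition psi :: real where
  "psi = 1 - phi"

lemma phi_bounds: "8 / 5 < phi" "phi < 17 / 10"
proof -
  have "sqrt 5 > 2.2" by (rule real_less_rsqrt) (simp add: power2_eq_square)
  moreover have "sqrt 5 < 2.4" by (rule real_less_lsqrt) (auto simp: power2_eq_square)
  ultimately show "8 / 5 < phi" "phi < 17 / 10" by (auto simp: phi_def)
qed

lemma phi_mult_phi: "phi * phi = phi + 1"
  by (simp add: phi_def field_simps)

lemma phi_mult_psi: "phi * psi = -1"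
  using phi_mult_phi by (simp add: psi_def algebra_simps)

lemma psi_mult_psi: "psi * psi = psi + 1"
  using phi_mult_phi by (simp add: psi_def algebra_simps)

lemma psi_bounds: "- 7 / 10 < psi" "psi < - 3 / 5"
  using phi_bounds by (auto simp: psi_def)

text \<open>Infinite descent: the form is the norm of \<open>a + b * phi\<close>, and it is odd
  unless \<open>a\<close> and \<open>b\<close> are both even, so a nonzero solution could be halved
  forever.\<close>

lemma norm_eq_zero_imp_eq_zero:
  fixes a b :: int
  assumes "a * a + a * b - b * b = 0"
  shows "a = 0 \<and> b = 0"
  using assms
proof (induction "nat (\<bar>a\<bar> + \<bar>b\<bar>)" arbitrary: a b rule: less_induct)
  case less
  have "even (a * a + a * b - b * b)" using less.prems by simp
  then have "even a" "even b" by auto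
  then obtain c d where cd: "a = 2 * c" "b = 2 * d" by (auto elim!: evenE)
  have "4 * (c * c + c * d - d * d) = 0"
    using less.prems by (simp add: cd algebra_simps)
  then have eq: "c * c + c * d - d * d = 0" by simp
  show ?case
  proof (cases "a = 0 \<and> b = 0")
    case False
    then have "nat (\<bar>c\<bar> + \<bar>d\<bar>) < nat (\<bar>a\<bar> + \<bar>b\<bar>)" by (auto simp: cd)
    from less.hyps[OF this eq] show ?thesis by (simp add: cd)
  qed
qed

lemma phi_lin_indep:
  assumes "of_int a + of_int b * phi = (0::real)"
  shows "a = 0" "b = 0"
proof -
  have "(of_int a + of_int b * phi) * (of_int a + of_int b * psi)
      = of_int a * of_int a + of_int a * of_int b * (phi + psi) + of_int b * of_int b * (phi * psi)"
    by (simp add: algebra_simps)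
  also have "\<dots> = of_int (a * a + a * b - b * b)"
    unfolding phi_mult_psi by (simp add: psi_def)
  finally have "of_int (a * a + a * b - b * b) = (0::real)"
    using assms by simp
  then have "a * a + a * b - b * b = 0" by linarith
  then show "a = 0" "b = 0" using norm_eq_zero_imp_eq_zero by auto
qed

text \<open>Binet's formula: \<open>phi\<close> and \<open>psi\<close> are the two roots of z^2 = z
  + 1, so both power sequences satisfy the Lucas recurrence.\<close>

lemma lucas_eq: "of_int (lucas n) = phi ^ n + psi ^ n"
proof (induction n rule: lucas.induct)
  case (3 n)
  have "phi ^ n * (phi * phi) + psi ^ n * (psi * psi)
      = (phi ^ Suc n + psi ^ Suc n) + (phi ^ n + psi ^ n)"
    unfolding phi_mult_phi psi_mult_psi by (simp add: algebra_simps)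
  with 3 show ?case by (simp add: algebra_simps)
qed (auto simp: psi_def)

lemma lucas_pos: "0 < lucas n"
  by (induction n rule: lucas.induct) auto

section \<open>Conjugation in the ring generated by \<open>phi\<close>\<close>

definition conj_pair :: "real \<Rightarrow> real \<Rightarrow> bool" where
  "conj_pair x y \<longleftrightarrow> (\<exists>a b. x = of_int a + of_int b * phi \<and> y = of_int a + of_int b * psi)"

lemma conj_pairE:
  assumes "conj_pair x y"
  obtains a b where "x = of_int a + of_int b * phi" "y = of_int a + of_int b * psi"
  using assms by (auto simp: conj_pair_def)

lemma conj_pair_of_int: "conj_pair (of_int k) (of_int k)"
  unfolding conj_pair_def by (rule exI[of _ k], rule exI[of _ 0]) simp

lemma conj_pair_add:
  assumes "conj_pair x y" "conj_pair x' y'"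
  shows "conj_pair (x + x') (y + y')"
proof -
  from assms obtain a b a' b' where "x = of_int a + of_int b * phi" "y = of_int a + of_int b * psi"
    "x' = of_int a' + of_int b' * phi" "y' = of_int a' + of_int b' * psi"
    by (auto simp: conj_pair_def)
  then show ?thesis unfolding conj_pair_def
    by (intro exI[of _ "a + a'"] exI[of _ "b + b'"]) (simp add: algebra_simps)
qed

lemma conj_pair_minus:
  assumes "conj_pair x y"
  shows "conj_pair (- x) (- y)"
proof -
  from assms obtain a b where "x = of_int a + of_int b * phi" "y = of_int a + of_int b * psi"
    by (rule conj_pairE)
  then show ?thesis unfolding conj_pair_def
    by (intro exI[of _ "- a"] exI[of _ "- b"]) simp
qed

lemma conj_pair_diff:
  assumes "conj_pair x y" "conj_pair x' y'"
  shows "conj_pair (x - x') (y - y')"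
  using conj_pair_add[OF assms(1) conj_pair_minus[OF assms(2)]] by simp

lemma conj_pair_mult:
  assumes "conj_pair x y" "conj_pair x' y'"
  shows "conj_pair (x * x') (y * y')"
proof -
  from assms obtain a b a' b' where eq: "x = of_int a + of_int b * phi" "y = of_int a + of_int b * psi"
    "x' = of_int a' + of_int b' * phi" "y' = of_int a' + of_int b' * psi"
    by (auto simp: conj_pair_def)
  have "x * x' = of_int a * of_int a' + (of_int a * of_int b' + of_int b * of_int a') * phi
      + of_int b * of_int b' * (phi * phi)"
    "y * y' = of_int a * of_int a' + (of_int a * of_int b' + of_int b * of_int a') * psi
      + of_int b * of_int b' * (psi * psi)"
    by (simp_all add: eq algebra_simps)
  then show ?thesis unfolding conj_pair_def phi_mult_phi psi_mult_psi
    by (intro exI[of _ "a * a' + b * b'"] exI[of _ "a * b' + b * a' + b * b'"])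
       (simp add: algebra_simps)
qed

lemma conj_pair_phi: "conj_pair phi psi"
  unfolding conj_pair_def by (rule exI[of _ 0], rule exI[of _ 1]) simp

lemma conj_pair_power: "conj_pair (phi ^ n) (psi ^ n)"
  by (induction n) (auto intro: conj_pair_mult conj_pair_phi conj_pair_of_int[of 1, simplified])

lemma inverse_phi: "inverse phi = - psi" and inverse_psi: "inverse psi = - phi"
  using phi_mult_psi by (auto intro!: inverse_unique simp: mult.commute)

lemma phi_neq_0: "phi \<noteq> 0" and psi_neq_0: "psi \<noteq> 0"
  using phi_bounds psi_bounds by auto

text \<open>Negative powers stay in the ring because \<open>phi\<close> is a unit with inverse
  \<open>- psi\<close>.\<close>

lemma conj_pair_power_int: "conj_pair (phi powi i) (psi powi i)"
proof (cases "i \<ge> 0")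
  case True
  then show ?thesis by (simp add: power_int_def conj_pair_power)
next
  case False
  have "conj_pair (- psi) (- phi)"
    unfolding conj_pair_def by (rule exI[of _ "-1"], rule exI[of _ 1]) (simp add: psi_def)
  then have "conj_pair ((- psi) ^ n) ((- phi) ^ n)" for n
    by (induction n)
       (auto simp del: mult_minus_left intro: conj_pair_mult conj_pair_of_int[of 1, simplified])
  with False show ?thesis by (simp add: power_int_def inverse_phi inverse_psi)
qed

lemma conj_pair_traceE:
  assumes "conj_pair x y"
  obtains t :: int where "x + y = of_int t"
proof -
  from assms obtain a b where "x = of_int a + of_int b * phi" "y = of_int a + of_int b * psi"
    by (rule conj_pairE)
  then have "x + y = of_int (2 * a + b)" by (simp add: psi_def algebra_simps)
  then show thesis by (rule that)
qed

section \<open>Sparse expansions\<close>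

text \<open>The set holds the positions of the digits 1; as digits are 0 or 1, it determines the
  digit function.\<close>

definition sparse :: "int set \<Rightarrow> bool" where
  "sparse D \<longleftrightarrow> finite D \<and> (\<forall>i\<in>D. i + 1 \<notin> D)"

definition expansion :: "real \<Rightarrow> int set \<Rightarrow> real" where
  "expansion z D = (\<Sum>i\<in>D. z powi i)"

lemma sparse_subset: "sparse D \<Longrightarrow> E \<subseteq> D \<Longrightarrow> sparse E"
  by (auto simp: sparse_def intro: finite_subset)

lemma sparse_finite: "sparse D \<Longrightarrow> finite D"
  by (simp add: sparse_def)

lemma sparse_translate: "sparse D \<Longrightarrow> sparse ((+) k ` D)"
  by (auto simp: sparse_def)

lemma expansion_translate:
  assumes "z \<noteq> 0"
  shows "expansion z ((+) k ` D) = z powi k * expansion z D"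
  using assms by (simp add: expansion_def sum.reindex power_int_add sum_distrib_left)

lemma expansion_Un:
  assumes "finite D" "finite E" "D \<inter> E = {}"
  shows "expansion z (D \<union> E) = expansion z D + expansion z E"
  using assms by (simp add: expansion_def sum.union_disjoint)

lemma expansion_remove:
  assumes "finite D" "i \<in> D"
  shows "expansion z D = z powi i + expansion z (D - {i})"
  using assms by (simp add: expansion_def sum.remove)

lemma conj_pair_expansion: "conj_pair (expansion phi D) (expansion psi D)"
  unfolding expansion_def
  by (induction D rule: infinite_finite_induct)
     (auto intro: conj_pair_add conj_pair_power_int conj_pair_of_int[of 0, simplified])

lemma expansion_phi_nonneg: "0 \<le> expansion phi D"
  using phi_bounds by (auto simp: expansion_def intro!: sum_nonneg)

lemma phi_powi_pos: "0 < phi powi i"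
  using phi_bounds by simp

lemma phi_powi_add_2: "phi powi (i + 2) = phi powi (i + 1) + phi powi i"
proof -
  have "phi powi (i + 2) = phi powi i * (phi * phi)"
    using phi_neq_0 by (simp add: power_int_add power2_eq_square)
  also have "\<dots> = phi powi (i + 1) + phi powi i"
    unfolding phi_mult_phi using phi_neq_0 by (simp add: power_int_add algebra_simps)
  finally show ?thesis .
qed

text \<open>The digits other than the top one at \<open>j\<close> lie below \<open>j - 1\<close>. By
  induction they add less than \<open>phi powi (j - 1)\<close>, so the total stays below
  \<open>phi powi (j + 1)\<close>.\<close>

lemma expansion_phi_less:
  assumes "sparse D" "D \<subseteq> {..<k}"
  shows "expansion phi D < phi powi k"
  using assms
proof (induction "card D" arbitrary: D k rule: less_induct)
  case less
  show ?case
  proof (cases "D = {}")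
    case True
    then show ?thesis by (simp add: expansion_def phi_powi_pos)
  next
    case False
    define j where "j = Max D"
    have fin: "finite D" using less.prems(1) by (rule sparse_finite)
    have le: "i \<le> j" if "i \<in> D" for i using fin that by (simp add: j_def)
    have jD: "j \<in> D" using False fin by (simp add: j_def)
    have "D - {j} \<subseteq> {..<j - 1}"
    proof
      fix i assume i: "i \<in> D - {j}"
      then have "i + 1 \<noteq> j" using less.prems(1) jD by (auto simp: sparse_def)
      then show "i \<in> {..<j - 1}" using i le[of i] by auto
    qed
    moreover have "card (D - {j}) < card D" using fin jD by (rule card_Diff1_less)
    moreover have "sparse (D - {j})" using less.prems(1) by (rule sparse_subset) auto
    ultimately have "expansion phi (D - {j}) < phi powi (j - 1)"
      using less.hyps by blast
    then have "expansion phi D < phi powi j + phi powi (j - 1)"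
      using expansion_remove[OF fin jD, of phi] by simp
    also have "\<dots> = phi powi (j + 1)"
      using phi_powi_add_2[of "j - 1"] by (simp add: add.commute)
    also have "\<dots> \<le> phi powi k"
      using less.prems(2) jD phi_bounds by (intro power_int_increasing) auto
    finally show ?thesis .
  qed
qed

lemma expansion_phi_ge:
  assumes "finite D" "i \<in> D"
  shows "phi powi i \<le> expansion phi D"
  using expansion_remove[OF assms, of phi] expansion_phi_nonneg[of "D - {i}"] by simp

lemma expansion_phi_less_1_imp:
  assumes "finite D" "expansion phi D < 1"
  shows "D \<subseteq> {..<0}"
proof
  fix i assume "i \<in> D"
  then have "phi powi i < 1"
    using expansion_phi_ge[OF assms(1)] assms(2) by fastforce
  moreover have "phi powi 0 \<le> phi powi i" if "0 \<le> i"
    using that phi_bounds by (intro power_int_increasing) auto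
  ultimately have "\<not> 0 \<le> i" by auto
  then show "i \<in> {..<0}" by simp
qed

text \<open>By \<open>expansion_phi_less\<close> and \<open>expansion_phi_ge\<close> a larger top
  position gives a larger value. Equal values thus share their top position, which is removed from
  both sets.\<close>

lemma expansion_phi_inj:
  assumes "sparse D" "sparse E" "expansion phi D = expansion phi E"
  shows "D = E"
  using assms
proof (induction "card D + card E" arbitrary: D E rule: less_induct)
  case less
  have fin: "finite D" "finite E" using less.prems by (auto simp: sparse_finite)
  have empty: "B = {}" if "finite B" "expansion phi B = expansion phi {}" for B
  proof (rule ccontr)
    assume "B \<noteq> {}"
    then obtain i where "i \<in> B" by auto
    then show False
      using expansion_phi_ge[OF that(1), of i] that(2) phi_powi_pos[of i] by (simp add: expansion_def)
  qed
  show ?case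
  proof (cases "D = {} \<or> E = {}")
    case True
    then show ?thesis using empty[OF fin(1)] empty[OF fin(2)] less.prems(3) by auto
  next
    case False
    have less_Max: "\<not> Max A < Max B"
      if "sparse A" "sparse B" "B \<noteq> {}" "expansion phi A = expansion phi B" for A B
    proof
      assume lt: "Max A < Max B"
      have "A \<subseteq> {..<Max B}"
      proof
        fix i assume "i \<in> A"
        then have "i \<le> Max A" using sparse_finite[OF that(1)] by simp
        with lt show "i \<in> {..<Max B}" by simp
      qed
      from expansion_phi_less[OF that(1) this]
      have "expansion phi A < phi powi Max B" .
      moreover have "phi powi Max B \<le> expansion phi B"
        using that(3) sparse_finite[OF that(2)] by (intro expansion_phi_ge) auto
      ultimately show False using that(4) by simp
    qed
    have eq: "Max D = Max E"
      using less_Max[of D E] less_Max[of E D] less.prems False by force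
    define j where "j = Max D"
    have j: "j \<in> D" "j \<in> E"
      using False fin Max_in[of D] Max_in[of E] eq by (auto simp: j_def)
    have "expansion phi (D - {j}) = expansion phi (E - {j})"
      using expansion_remove[OF fin(1) j(1), of phi] expansion_remove[OF fin(2) j(2), of phi]
        less.prems(3) by simp
    moreover have "sparse (D - {j})" "sparse (E - {j})"
      using less.prems by (auto intro: sparse_subset)
    moreover have "card (D - {j}) + card (E - {j}) < card D + card E"
      using card_Diff1_less[OF fin(1) j(1)] card_Diff1_less[OF fin(2) j(2)] by simp
    ultimately have "D - {j} = E - {j}" using less.hyps by blast
    then show ?thesis using j by blast
  qed
qed

text \<open>The effect on the conjugate of appending a last digit 0.\<close>

lemma psi_mult_window:
  assumes "-1 < z" "z < phi"
  shows "-1 < psi * z" "psi * z < - psi"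
proof -
  have "psi * phi < psi * z" using assms psi_bounds by (intro mult_strict_left_mono_neg) auto
  then show "-1 < psi * z" using phi_mult_psi by (simp add: mult.commute)
  have "psi * z < psi * (-1)" using assms psi_bounds by (intro mult_strict_left_mono_neg) auto
  then show "psi * z < - psi" by simp
qed

text \<open>The effect of appending the digits 01. The new window is disjoint from the one for a
  last digit 0, so the conjugate reveals the last digit.\<close>

lemma one_plus_psi_sq_mult_window:
  assumes "-1 < z" "z < phi"
  shows "- psi < 1 + psi * (psi * z)" "1 + psi * (psi * z) < phi"
proof -
  note * = psi_mult_window[OF assms]
  have "psi * (- psi) < psi * (psi * z)"
    using * psi_bounds by (intro mult_strict_left_mono_neg) auto
  then show "- psi < 1 + psi * (psi * z)" using psi_mult_psi by simp
  have "psi * (psi * z) < psi * (-1)"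
    using * psi_bounds by (intro mult_strict_left_mono_neg) auto
  then show "1 + psi * (psi * z) < phi" by (simp add: psi_def)
qed

text \<open>The tail \<open>psi\<^sup>e y\<close> stands for the conjugate of the digits at positions \<open>\<ge> e\<close>.\<close>

lemma expansion_psi_window:
  assumes "sparse Q" "Q \<subseteq> {k..e - 2}" "k \<le> e" "-1 < y" "y < phi"
  shows "\<exists>z. -1 < z \<and> z < phi \<and> expansion psi Q + psi powi e * y = psi powi k * z"
  using assms(1-3)
proof (induction "nat (e - k)" arbitrary: Q k rule: less_induct)
  case less
  consider "k = e" | "k < e" "k \<notin> Q" | "k \<in> Q" using less.prems by force
  then show ?case
  proof cases
    case 1
    then have "Q = {}" using less.prems by auto
    then show ?thesis using assms 1 by (intro exI[of _ y]) (simp add: expansion_def)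
  next
    case 2
    have sub: "Q \<subseteq> {k + 1..e - 2}"
    proof
      fix i assume "i \<in> Q"
      moreover from this have "i \<noteq> k" using 2 by auto
      ultimately show "i \<in> {k + 1..e - 2}" using less.prems(2) by force
    qed
    then obtain z where z: "-1 < z" "z < phi"
      "expansion psi Q + psi powi e * y = psi powi (k + 1) * z"
      using less.hyps[OF _ less.prems(1) sub] 2 by auto
    then show ?thesis
      using psi_mult_window[OF z(1,2)] psi_bounds phi_bounds psi_neq_0
      by (intro exI[of _ "psi * z"]) (auto simp: power_int_add)
  next
    case 3
    have sub: "Q - {k} \<subseteq> {k + 2..e - 2}"
    proof
      fix i assume i: "i \<in> Q - {k}"
      moreover have "i \<noteq> k + 1" using i less.prems(1) 3 by (auto simp: sparse_def)
      ultimately show "i \<in> {k + 2..e - 2}" using less.prems(2) by force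
    qed
    \<comment> \<open>A digit 1 at \<open>k\<close> also uses up position \<open>k + 1\<close>; the
      bound \<open>e - 2\<close> on \<open>Q\<close> leaves room for this below the tail.\<close>
    have e: "k + 2 \<le> e" using 3 less.prems(2) by auto
    have "sparse (Q - {k})" using less.prems(1) by (rule sparse_subset) auto
    then obtain z where z: "-1 < z" "z < phi"
      "expansion psi (Q - {k}) + psi powi e * y = psi powi (k + 2) * z"
      using less.hyps[OF _ _ sub] e by auto
    have "expansion psi Q = psi powi k + expansion psi (Q - {k})"
      using 3 less.prems(1) by (intro expansion_remove) (auto simp: sparse_finite)
    then show ?thesis
      using one_plus_psi_sq_mult_window[OF z(1,2)] psi_bounds phi_bounds psi_neq_0 z(3)
      by (intro exI[of _ "1 + psi * (psi * z)"])
         (auto simp: power_int_add power2_eq_square algebra_simps)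
  qed
qed

section \<open>Phi-integers\<close>

definition phi_integer :: "real \<Rightarrow> real \<Rightarrow> bool" where
  "phi_integer x y \<longleftrightarrow> conj_pair x y \<and> 0 \<le> x \<and> -1 < y \<and> y < phi"

lemma expansion_phi_integer:
  assumes "sparse E" "E \<subseteq> {0..}"
  shows "phi_integer (expansion phi E) (expansion psi E)"
proof -
  have fin: "finite E" using assms(1) by (rule sparse_finite)
  \<comment> \<open>The tail is taken to be 0. The summand 2 matches the bound \<open>e - 2\<close>,
    and inserting 0 covers the empty set.\<close>
  define e where "e = Max (insert 0 E) + 2"
  have "Max (insert 0 E) \<ge> 0" using fin by simp
  then have "0 \<le> e" by (simp add: e_def)
  moreover have "E \<subseteq> {0..e - 2}" using assms(2) fin by (auto simp: e_def)
  ultimately obtain z where "-1 < z" "z < phi" "expansion psi E + psi powi e * 0 = psi powi 0 * z"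
    using expansion_psi_window[OF assms(1), of 0 e 0] phi_bounds by auto
  then show ?thesis
    using conj_pair_expansion[of E] by (simp add: phi_integer_def expansion_phi_nonneg)
qed

text \<open>The two numbers differ by \<open>b * (phi - psi)\<close>, and \<open>phi - psi\<close>
  exceeds \<open>phi\<close>, so a negative \<open>b\<close> would push the difference below
  \<open>- phi\<close>.\<close>

lemma phi_integer_coord_nonneg:
  assumes "0 \<le> of_int a + of_int b * phi" "of_int a + of_int b * psi < phi"
  shows "0 \<le> b"
proof (rule ccontr)
  assume "\<not> 0 \<le> b"
  then have "of_int b \<le> (-1::real)" by linarith
  then have "of_int b * (phi - psi) \<le> (-1) * (phi - psi)"
    using phi_bounds psi_bounds by (intro mult_right_mono) auto
  moreover have "of_int b * (phi - psi) > - phi" using assms by (simp add: algebra_simps)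
  ultimately show False using psi_bounds by simp
qed

text \<open>Needed to remove a lowest digit 1. As \<open>x - y = b * (phi - psi)\<close>, having
  \<open>x < 1\<close> and \<open>0 < y\<close> would force \<open>b = 0\<close>, making
  \<open>x\<close> an integer strictly between 0 and 1.\<close>

lemma phi_integer_ge_1:
  assumes "phi_integer x y" "0 < y"
  shows "1 \<le> x"
proof (rule ccontr)
  assume "\<not> 1 \<le> x"
  then have x: "0 \<le> x" "x < 1" using assms by (auto simp: phi_integer_def)
  obtain a b where ab: "x = of_int a + of_int b * phi" "y = of_int a + of_int b * psi"
    using assms by (auto simp: phi_integer_def elim: conj_pairE)
  have "0 \<le> b" using assms ab by (intro phi_integer_coord_nonneg) (auto simp: phi_integer_def)
  moreover have "\<not> 1 \<le> b"
  proof
    assume "1 \<le> b"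
    then have "1 * (phi - psi) \<le> of_int b * (phi - psi)"
      using phi_bounds psi_bounds by (intro mult_right_mono) auto
    then show False using x assms(2) ab phi_bounds psi_bounds by (simp add: algebra_simps)
  qed
  ultimately have "b = 0" by simp
  then show False using ab x assms(2) by simp
qed

lemma div_phi_coords:
  "- psi * (of_int c + of_int d * phi) = of_int (d - c) + of_int c * phi"
  "- phi * (of_int c + of_int d * psi) = of_int (d - c) + of_int c * psi"
proof -
  have "- psi * (of_int c + of_int d * phi) = - of_int c * psi - of_int d * (phi * psi)"
    "- phi * (of_int c + of_int d * psi) = - of_int c * phi - of_int d * (phi * psi)"
    by (simp_all add: algebra_simps)
  then show "- psi * (of_int c + of_int d * phi) = of_int (d - c) + of_int c * phi"
    "- phi * (of_int c + of_int d * psi) = of_int (d - c) + of_int c * psi"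
    unfolding phi_mult_psi by (simp_all add: psi_def algebra_simps)
qed

text \<open>Removal of a last digit 0, that is division by \<open>phi\<close>; the bound on
  \<open>y\<close> keeps the new conjugate above -1.\<close>

lemma phi_integer_shift1:
  assumes "phi_integer x y" "y < - psi"
  shows "phi_integer (- psi * x) (- phi * y)"
proof -
  have "conj_pair (- psi) (- phi)"
    using conj_pair_power_int[of "-1"] by (simp add: inverse_phi inverse_psi power_int_minus)
  moreover have "phi * y < phi * (- psi)"
    using assms phi_bounds by (intro mult_strict_left_mono) auto
  moreover have "phi * (-1) < phi * y"
    using assms phi_bounds by (intro mult_strict_left_mono) (auto simp: phi_integer_def)
  ultimately show ?thesis
    using assms psi_bounds phi_mult_psi conj_pair_mult[of "- psi" "- phi" x y]
    by (simp add: phi_integer_def mult_nonpos_nonneg)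
qed

text \<open>Subtraction of 1 followed by division by \<open>phi\<close>. Positivity of
  \<open>y\<close> suffices here, because it implies \<open>1 \<le> x\<close>.\<close>

lemma phi_integer_shift2:
  assumes "phi_integer x y" "0 < y"
  shows "phi_integer (- psi * (x - 1)) (- phi * (y - 1))"
proof -
  have "conj_pair (- psi) (- phi)"
    using conj_pair_power_int[of "-1"] by (simp add: inverse_phi inverse_psi power_int_minus)
  moreover have "conj_pair (x - 1) (y - 1)"
    using assms conj_pair_of_int[of 1] by (auto simp: phi_integer_def intro!: conj_pair_diff)
  moreover have "phi * (y - 1) < phi * (phi - 1)"
    using assms phi_bounds by (intro mult_strict_left_mono) (auto simp: phi_integer_def)
  moreover have "phi * (-1) < phi * (y - 1)"
    using assms phi_bounds by (intro mult_strict_left_mono) (auto simp: phi_integer_def)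
  moreover have "0 \<le> - psi * (x - 1)"
    using phi_integer_ge_1[OF assms] psi_bounds by (intro mult_nonneg_nonneg) auto
  ultimately show ?thesis
    using phi_mult_phi conj_pair_mult[of "- psi" "- phi" "x - 1" "y - 1"]
    by (simp add: phi_integer_def right_diff_distrib)
qed

text \<open>The last digit is read off the conjugate: 0 below \<open>- psi\<close>, 1 above. A digit
  1 is removed together with the 0 next to it. The induction is on \<open>a + 2 * b\<close>, which
  is one less than the index of the phi-integer.\<close>

lemma phi_integer_expansion:
  assumes "phi_integer x y"
  shows "\<exists>E. sparse E \<and> E \<subseteq> {0..} \<and> expansion phi E = x"
proof -
  have *: "\<exists>E. sparse E \<and> E \<subseteq> {0..} \<and> expansion phi E = of_int a + of_int b * phi"
    if "phi_integer (of_int a + of_int b * phi) (of_int a + of_int b * psi)" for a b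
    using that
  proof (induction "nat (a + 2 * b)" arbitrary: a b rule: less_induct)
    case less
    define x y where xy: "x = of_int a + of_int b * phi" "y = of_int a + of_int b * psi"
    have P: "phi_integer x y" using less.prems by (simp add: xy)
    have b: "0 \<le> b" using less.prems by (auto simp: phi_integer_def intro: phi_integer_coord_nonneg)
    have pos: "0 < a + 2 * b" if "x \<noteq> 0"
    proof -
      have "x + of_int b * (2 - phi) = of_int (a + 2 * b)" by (simp add: xy algebra_simps)
      moreover have "0 < x" using P that by (simp add: phi_integer_def)
      moreover have "0 \<le> of_int b * (2 - phi)" using b phi_bounds by simp
      ultimately have "(0::real) < of_int (a + 2 * b)" by linarith
      then show ?thesis by linarith
    qed
    consider "x = 0" | "x \<noteq> 0" "y < - psi" | "x \<noteq> 0" "- psi \<le> y" by linarith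
    then show ?case
    proof cases
      case 1
      then show ?thesis by (intro exI[of _ "{}"]) (auto simp: sparse_def expansion_def xy)
    next
      case 2
      have "b \<noteq> 0"
      proof
        assume "b = 0"
        then show False using P 2 psi_bounds by (auto simp: xy phi_integer_def)
      qed
      \<comment> \<open>Division by \<open>phi\<close> sends \<open>(a, b)\<close> to
        \<open>(b - a, a)\<close>, so the measure becomes \<open>a + b\<close>.\<close>
      then have lt: "nat (b - a + 2 * a) < nat (a + 2 * b)" using b pos[OF 2(1)] by auto
      have eq: "- psi * x = of_int (b - a) + of_int a * phi"
        "- phi * y = of_int (b - a) + of_int a * psi"
        unfolding xy div_phi_coords by simp_all
      then have "phi_integer (of_int (b - a) + of_int a * phi) (of_int (b - a) + of_int a * psi)"
        using phi_integer_shift1[OF P 2(2)] by simp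
      from less.hyps[OF lt this] obtain E where E: "sparse E" "E \<subseteq> {0..}"
        "expansion phi E = - psi * x" using eq by auto
      have "expansion phi ((+) 1 ` E) = phi * (- psi * x)"
        using E phi_neq_0 by (simp add: expansion_translate)
      also have "\<dots> = x" using phi_mult_psi by (simp flip: mult.assoc)
      finally show ?thesis using E
        by (intro exI[of _ "(+) 1 ` E"]) (auto simp: sparse_translate xy)
    next
      case 3
      have P2: "phi_integer (- psi * (- psi * (x - 1))) (- phi * (- phi * (y - 1)))"
      proof (rule phi_integer_shift1[OF phi_integer_shift2[OF P]])
        show "0 < y" using 3 psi_bounds by simp
        \<comment> \<open>The borderline value belongs to \<open>a = 0\<close>,
          \<open>b = -1\<close>. Strictness is what allows the second division, which removes the 0
          next to the last digit.\<close>
        have "y \<noteq> - psi"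
        proof
          assume "y = - psi"
          then have "of_int (a + b + 1) + of_int (- b - 1) * phi = 0"
            by (simp add: xy psi_def algebra_simps)
          then have "- b - 1 = 0" by (rule phi_lin_indep)
          then show False using b by simp
        qed
        then have "phi * (y - 1) > phi * (- psi - 1)"
          using 3 phi_bounds by (intro mult_strict_left_mono) auto
        then show "- phi * (y - 1) < - psi"
          using phi_mult_psi by (simp add: psi_def algebra_simps)
      qed
      have eq: "- psi * (- psi * (x - 1)) = of_int (2 * (a - 1) - b) + of_int (b - (a - 1)) * phi"
        "- phi * (- phi * (y - 1)) = of_int (2 * (a - 1) - b) + of_int (b - (a - 1)) * psi"
      proof -
        have x1: "x - 1 = of_int (a - 1) + of_int b * phi" "y - 1 = of_int (a - 1) + of_int b * psi"
          by (simp_all add: xy)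
        show "- psi * (- psi * (x - 1)) = of_int (2 * (a - 1) - b) + of_int (b - (a - 1)) * phi"
          "- phi * (- phi * (y - 1)) = of_int (2 * (a - 1) - b) + of_int (b - (a - 1)) * psi"
          unfolding x1 div_phi_coords by (simp_all add: algebra_simps)
      qed
      have "of_int b * psi \<le> of_int b * 1"
        using b psi_bounds by (intro mult_left_mono) auto
      then have "(0::real) < of_int (a + b)" using 3 psi_bounds by (simp add: xy)
      then have "0 < a + b" by linarith
      \<comment> \<open>After the subtraction of 1 and two divisions by \<open>phi\<close> the
        measure is \<open>b\<close>.\<close>
      then have lt: "nat (2 * (a - 1) - b + 2 * (b - (a - 1))) < nat (a + 2 * b)" using b by simp
      from less.hyps[OF lt] P2 obtain E where E: "sparse E" "E \<subseteq> {0..}"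
        "expansion phi E = - psi * (- psi * (x - 1))" unfolding eq by auto
      define F where "F = (+) 2 ` E"
      have "expansion phi F = phi * (phi * (- psi * (- psi * (x - 1))))"
        using E phi_neq_0 by (simp add: expansion_translate F_def power2_eq_square)
      also have "\<dots> = (phi * psi) * (phi * psi) * (x - 1)" by (simp add: algebra_simps)
      finally have F: "expansion phi F = x - 1" by (simp add: phi_mult_psi)
      have sub: "F \<subseteq> {2..}" "sparse F" using E by (auto simp: F_def sparse_translate)
      have sparse: "sparse (insert 0 F)" using sub by (force simp: sparse_def)
      have "expansion phi (insert 0 F) = 1 + expansion phi (insert 0 F - {0})"
        using expansion_remove[OF sparse_finite[OF sparse], of 0 phi] by simp
      also have "insert 0 F - {0} = F" using sub by auto
      finally have "expansion phi (insert 0 F) = x" using F by simp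
      then show ?thesis using sparse sub
        by (intro exI[of _ "insert 0 F"]) (auto simp: xy)
    qed
  qed
  obtain a b where "x = of_int a + of_int b * phi" "y = of_int a + of_int b * psi"
    using assms by (auto simp: phi_integer_def elim: conj_pairE)
  then show ?thesis using assms *[of a b] by simp
qed

section \<open>Prescribed low digits\<close>

text \<open>Multiplication by a high power of \<open>phi\<close> contracts the conjugate into the
  window, since \<open>psi\<close> has absolute value below 1; the expansion of the resulting
  phi-integer is then shifted back.\<close>

lemma conj_pair_expansion_exists:
  assumes "conj_pair x y" "0 \<le> x"
  shows "\<exists>D. sparse D \<and> expansion phi D = x"
proof -
  have "\<bar>psi\<bar> < 1" using psi_bounds by simp
  then have "psi * psi < 1" unfolding psi_mult_psi using psi_bounds by simp
  then have "(\<lambda>n. (psi * psi) ^ n * y) \<longlonglongrightarrow> 0"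
    by (intro tendsto_mult_left_zero LIMSEQ_realpow_zero) auto
  then have "\<forall>\<^sub>F n in sequentially. norm ((psi * psi) ^ n * y) < 1"
    using tendstoD[of "\<lambda>n. (psi * psi) ^ n * y" 0 sequentially 1] by (simp add: dist_norm)
  then obtain n where n: "\<bar>(psi * psi) ^ n * y\<bar> < 1"
    by (auto simp: eventually_sequentially)
  have eq: "(z * z) ^ n = z ^ (2 * n)" for z :: real
    by (simp add: power_mult power2_eq_square)
  have "phi_integer (phi ^ (2 * n) * x) (psi ^ (2 * n) * y)"
    using assms n phi_bounds unfolding eq
    by (auto simp: phi_integer_def conj_pair_mult conj_pair_power abs_less_iff)
  from phi_integer_expansion[OF this] obtain E
    where E: "sparse E" "expansion phi E = phi ^ (2 * n) * x" by auto
  have "expansion phi ((+) (- int (2 * n)) ` E) = phi powi (- int (2 * n)) * phi powi (int (2 * n)) * x"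
    using expansion_translate[OF phi_neq_0, of "- int (2 * n)" E] E(2)
    by (simp only: mult.assoc power_int_of_nat)
  also have "\<dots> = x"
    using phi_neq_0 by (simp add: power_int_minus)
  finally show ?thesis using E(1) by (blast intro: sparse_translate)
qed

section \<open>Translation from digit functions to sets of positions\<close>

lemma is_base_phi_expansion_iff:
  "is_base_phi_expansion N d \<longleftrightarrow>
     (\<exists>D. sparse D \<and> expansion phi D = real N \<and> d = (\<lambda>i. of_bool (i \<in> D)))"
proof
  assume d: "is_base_phi_expansion N d"
  define D where "D = {i. d i \<noteq> 0}"
  have ind: "d i = of_bool (i \<in> D)" for i
  proof -
    have "d i \<in> {0, 1}" using d by (simp add: is_base_phi_expansion_def)
    then show ?thesis by (auto simp: D_def)
  qed
  have "\<forall>i. d i * d (i + 1) = 0" "finite D"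
    using d unfolding is_base_phi_expansion_def D_def by blast+
  then have "sparse D" by (force simp: sparse_def ind split: if_splits)
  moreover have "real N = (\<Sum>i\<in>D. real (d i) * phi powi i)"
    using d by (simp add: is_base_phi_expansion_def D_def)
  then have "expansion phi D = real N"
    unfolding expansion_def by (auto simp: ind intro: sum.cong)
  ultimately show "\<exists>D. sparse D \<and> expansion phi D = real N \<and> d = (\<lambda>i. of_bool (i \<in> D))"
    using ind by auto
next
  assume "\<exists>D. sparse D \<and> expansion phi D = real N \<and> d = (\<lambda>i. of_bool (i \<in> D))"
  then show "is_base_phi_expansion N d"
    by (auto simp: is_base_phi_expansion_def sparse_def expansion_def)
qed

lemma digit_eq:
  assumes "sparse D" "expansion phi D = real N"
  shows "digit N = (\<lambda>i. of_bool (i \<in> D))"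
  unfolding digit_def
proof (rule the_equality)
  show "is_base_phi_expansion N (\<lambda>i. of_bool (i \<in> D))"
    unfolding is_base_phi_expansion_iff using assms by blast
next
  fix d assume "is_base_phi_expansion N d"
  then obtain E where E: "sparse E" "expansion phi E = real N" "d = (\<lambda>i. of_bool (i \<in> E))"
    unfolding is_base_phi_expansion_iff by blast
  then have "E = D" using assms by (intro expansion_phi_inj) auto
  with E show "d = (\<lambda>i. of_bool (i \<in> D))" by simp
qed

text \<open>Words start with the most significant digit, so reversal makes list indices agree with
  positions.\<close>

definition ones :: "nat list \<Rightarrow> int set" where
  "ones w = int ` {i. i < length w \<and> rev w ! i = 1}"

text \<open>The length is kept apart from the set of ones, so a leading 0 can be added to a word
  without changing \<open>Q\<close>.\<close>

definition with_low_digits :: "nat \<Rightarrow> int set \<Rightarrow> nat set" where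
  "with_low_digits m Q =
     {N. \<exists>D. sparse D \<and> expansion phi D = real N \<and> D \<inter> {0..<int m} = Q}"

lemma map_digit_eq_iff:
  assumes "set v \<subseteq> {0, 1}" and D: "sparse D" "expansion phi D = real N"
  shows "map (\<lambda>i. digit N (int i)) [0..<length v] = v \<longleftrightarrow>
    D \<inter> {0..<int (length v)} = int ` {i. i < length v \<and> v ! i = 1}"
proof -
  have "map (\<lambda>i. digit N (int i)) [0..<length v] = v \<longleftrightarrow>
      map (\<lambda>i. digit N (int i)) [0..<length v] = map ((!) v) [0..<length v]"
    by (simp only: map_nth)
  also have "\<dots> \<longleftrightarrow> (\<forall>i<length v. of_bool (int i \<in> D) = v ! i)"
    unfolding map_eq_conv digit_eq[OF D] set_upt by (simp only: Ball_def atLeastLessThan_iff) simp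
  also have "\<dots> \<longleftrightarrow> (\<forall>i<length v. int i \<in> D \<longleftrightarrow> v ! i = 1)"
  proof (rule all_cong1, rule imp_cong[OF refl])
    fix i assume "i < length v"
    then have "v ! i = 0 \<or> v ! i = 1" using assms(1) nth_mem[of i v] by blast
    then show "of_bool (int i \<in> D) = v ! i \<longleftrightarrow> (int i \<in> D \<longleftrightarrow> v ! i = 1)" by auto
  qed
  also have "\<dots> \<longleftrightarrow> {i. i < length v \<and> int i \<in> D} = {i. i < length v \<and> v ! i = 1}"
    by blast
  also have "\<dots> \<longleftrightarrow>
      int ` {i. i < length v \<and> int i \<in> D} = int ` {i. i < length v \<and> v ! i = 1}"
    by (rule inj_image_eq_iff[symmetric]) (rule inj_of_nat)
  also have "int ` {i. i < length v \<and> int i \<in> D} = D \<inter> int ` {..<length v}"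
    by auto
  also have "int ` {..<length v} = {0..<int (length v)}"
    by (simp only: image_int_atLeastLessThan lessThan_atLeast0 of_nat_0)
  finally show ?thesis .
qed

lemma occurrences_eq:
  assumes "set w \<subseteq> {0, 1}"
  shows "occurrences w = with_low_digits (length w) (ones w)"
proof -
  have "low_digits (length w) N = w \<longleftrightarrow> D \<inter> {0..<int (length w)} = ones w"
    if D: "sparse D" "expansion phi D = real N" for N D
  proof -
    have "low_digits (length w) N = w \<longleftrightarrow>
        map (\<lambda>i. digit N (int i)) [0..<length w] = rev w"
      unfolding low_digits_def rev_map[symmetric] by (metis rev_rev_ident)
    then show ?thesis
      using map_digit_eq_iff[OF _ D, of "rev w"] assms by (simp add: ones_def)
  qed
  moreover have "\<exists>D. sparse D \<and> expansion phi D = real N" for N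
    using conj_pair_of_int[of "int N"] by (intro conj_pair_expansion_exists) auto
  ultimately show ?thesis
    unfolding occurrences_def with_low_digits_def by (intro Collect_cong) metis
qed

lemma expansion_translate_phi: "expansion phi ((+) (int m) ` D) = phi ^ m * expansion phi D"
  using phi_neq_0 by (simp add: expansion_translate)

text \<open>The digits at negative positions contribute an amount in [0, 1), so the integer is the
  ceiling of the rest. \<open>Q\<close> avoids 0 and \<open>m - 1\<close>, hence arbitrary sparse
  parts below and above can be attached without creating adjacent ones.\<close>

lemma with_low_digits_eq:
  assumes "1 \<le> m" "sparse Q" "Q \<subseteq> {1..int m - 2}"
  shows "int ` with_low_digits m Q =
    {\<lceil>phi ^ m * x + expansion phi Q\<rceil> | x y. phi_integer x y}"
proof (intro subset_antisym subsetI)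
  fix k assume "k \<in> int ` with_low_digits m Q"
  then obtain N D where D: "k = int N" "sparse D" "expansion phi D = real N" "D \<inter> {0..<int m} = Q"
    by (auto simp: with_low_digits_def)
  define A B where "A = D \<inter> {..<0}" and "B = D \<inter> {int m..}"
  have "D = A \<union> (Q \<union> B)" unfolding A_def B_def D(4)[symmetric] by auto
  moreover have fin: "finite D" using D(2) by (rule sparse_finite)
  moreover have "A \<inter> (Q \<union> B) = {}" "Q \<inter> B = {}"
    unfolding A_def B_def D(4)[symmetric] by auto
  moreover have "finite A" "finite Q" "finite B"
    using fin assms(2) by (auto simp: A_def B_def sparse_finite)
  ultimately have sum: "expansion phi D = expansion phi A + (expansion phi Q + expansion phi B)"
    by (metis expansion_Un finite_Un)
  have "sparse A" using D(2) by (rule sparse_subset) (auto simp: A_def)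
  then have "expansion phi A < phi powi 0"
    by (rule expansion_phi_less) (auto simp: A_def)
  then have A: "0 \<le> expansion phi A" "expansion phi A < 1"
    by (auto simp: expansion_phi_nonneg)
  define E where "E = (+) (- int m) ` B"
  have "sparse E" unfolding E_def
    using D(2) by (intro sparse_translate) (rule sparse_subset[of D], auto simp: B_def)
  moreover have "E \<subseteq> {0..}" by (auto simp: E_def B_def)
  ultimately have E: "phi_integer (expansion phi E) (expansion psi E)"
    by (rule expansion_phi_integer)
  have "(+) (int m) ` E = B" by (auto simp: E_def image_image)
  then have "expansion phi B = phi ^ m * expansion phi E"
    by (metis expansion_translate_phi)
  then have "\<lceil>phi ^ m * expansion phi E + expansion phi Q\<rceil> = k"
    using sum A D by (intro ceiling_unique) auto
  then show "k \<in> {\<lceil>phi ^ m * x + expansion phi Q\<rceil> | x y. phi_integer x y}"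
    using E by blast
next
  fix k assume "k \<in> {\<lceil>phi ^ m * x + expansion phi Q\<rceil> | x y. phi_integer x y}"
  then obtain x y where k: "k = \<lceil>phi ^ m * x + expansion phi Q\<rceil>" and xy: "phi_integer x y" by auto
  from phi_integer_expansion[OF xy] obtain E
    where E: "sparse E" "E \<subseteq> {0..}" "expansion phi E = x" by auto
  define B where "B = (+) (int m) ` E"
  have B: "sparse B" "B \<subseteq> {int m..}" "expansion phi B = phi ^ m * x"
    using E by (auto simp: B_def sparse_translate expansion_translate_phi)
  \<comment> \<open>The missing part lies in the ring and in [0, 1), so its expansion uses negative
    positions only.\<close>
  define f where "f = of_int k - (phi ^ m * x + expansion phi Q)"
  have f: "0 \<le> f" "f < 1" unfolding f_def k by linarith+
  have "conj_pair f (of_int k - (psi ^ m * y + expansion psi Q))"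
    unfolding f_def using xy
    by (intro conj_pair_diff conj_pair_add conj_pair_mult conj_pair_power conj_pair_expansion
          conj_pair_of_int) (simp add: phi_integer_def)
  then obtain A where A: "sparse A" "expansion phi A = f"
    using conj_pair_expansion_exists f by blast
  then have A0: "A \<subseteq> {..<0}"
    using expansion_phi_less_1_imp f by (simp add: sparse_finite)
  define D where "D = A \<union> (Q \<union> B)"
  have "sparse D"
    unfolding sparse_def
  proof (intro conjI ballI)
    show "finite D" using A B assms by (auto simp: D_def sparse_finite)
    fix i assume "i \<in> D"
    then consider "i \<in> A" | "i \<in> Q" | "i \<in> B" by (auto simp: D_def)
    then show "i + 1 \<notin> D"
    proof cases
      case 1
      then show ?thesis using A(1) A0 assms(1,3) B(2) by (force simp: D_def sparse_def)
    next
      case 2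
      then show ?thesis using assms A0 B(2) by (force simp: D_def sparse_def)
    next
      case 3
      then show ?thesis using assms A0 B(1,2) by (force simp: D_def sparse_def)
    qed
  qed
  moreover have "expansion phi D = of_int k"
  proof -
    have "A \<inter> (Q \<union> B) = {}" "Q \<inter> B = {}" using A0 assms(3) B(2) by force+
    then have "expansion phi D = f + (expansion phi Q + phi ^ m * x)"
      unfolding D_def using A B assms(2) by (simp add: expansion_Un sparse_finite)
    then show ?thesis by (simp add: f_def)
  qed
  moreover have "D \<inter> {0..<int m} = Q" using A0 assms(3) B(2) by (force simp: D_def)
  moreover have "0 \<le> k"
    using expansion_phi_nonneg[of D] \<open>expansion phi D = of_int k\<close> by simp
  ultimately show "k \<in> int ` with_low_digits m Q"
    unfolding with_low_digits_def by (intro image_eqI[of _ _ "nat k"]) auto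
qed

section \<open>Beatty sequences\<close>

text \<open>The number \<open>y + 1\<close> ranges between 0 and phi squared. Multiplication by
  \<open>2 - phi\<close>, the inverse of phi squared, turns this into
  \<open>b < n * (2 - phi) < b + 1\<close>, which fixes the floor of \<open>n * phi\<close>.\<close>

lemma phi_integer_iff:
  fixes a b :: int
  defines "n \<equiv> a + 2 * b + 1"
  shows "phi_integer (of_int a + of_int b * phi) (of_int a + of_int b * psi) \<longleftrightarrow>
    1 \<le> n \<and> \<lfloor>of_int n * phi\<rfloor> = 2 * n - 1 - b"
proof -
  define x y where xy: "x = of_int a + of_int b * phi" "y = of_int a + of_int b * psi"
  have one: "(2 - phi) * (1 + phi) = 1" using phi_mult_phi by (simp add: algebra_simps)
  have n: "of_int n = y + 1 + of_int b * (1 + phi)"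
    by (simp add: xy n_def psi_def algebra_simps)
  have n2: "of_int n * (2 - phi) = (y + 1) * (2 - phi) + of_int b"
  proof -
    have "of_int n * (2 - phi) = (y + 1) * (2 - phi) + of_int b * ((2 - phi) * (1 + phi))"
      unfolding n by (simp add: algebra_simps)
    then show ?thesis unfolding one by simp
  qed
  have lower: "-1 < y \<longleftrightarrow> of_int b < of_int n * (2 - phi)"
    unfolding n2 using phi_bounds by (auto simp: zero_less_mult_iff)
  have upper: "y < phi \<longleftrightarrow> of_int n * (2 - phi) < of_int b + 1"
  proof -
    have "y < phi \<longleftrightarrow> (y + 1) * (2 - phi) < (1 + phi) * (2 - phi)"
      using phi_bounds by (simp add: mult_less_cancel_right)
    then show ?thesis unfolding n2 using one by (simp add: mult.commute)
  qed
  have diff: "x - y = of_int b * (phi - psi)" by (simp add: xy algebra_simps)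
  show ?thesis unfolding xy[symmetric]
  proof
    assume P: "phi_integer x y"
    have b: "0 \<le> b" using P
      by (intro phi_integer_coord_nonneg[of a b]) (auto simp: phi_integer_def xy)
    have "of_int (n - 1) = x + of_int b * (2 - phi)" by (simp add: xy n_def algebra_simps)
    moreover have "0 \<le> of_int b * (2 - phi)" using b phi_bounds by simp
    ultimately have "(0::real) \<le> of_int (n - 1)" using P by (simp add: phi_integer_def)
    moreover have "\<lfloor>of_int n * phi\<rfloor> = 2 * n - 1 - b"
      using P lower upper by (intro floor_unique) (auto simp: phi_integer_def algebra_simps)
    ultimately show "1 \<le> n \<and> \<lfloor>of_int n * phi\<rfloor> = 2 * n - 1 - b" by auto
  next
    assume R: "1 \<le> n \<and> \<lfloor>of_int n * phi\<rfloor> = 2 * n - 1 - b"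
    then have le: "of_int (2 * n - 1 - b) \<le> of_int n * phi" "of_int n * phi < of_int (2 * n - 1 - b) + 1"
      by linarith+
    \<comment> \<open>The floor yields only a weak inequality on the side of \<open>y < phi\<close>;
      irrationality makes it strict.\<close>
    have "of_int n * phi \<noteq> of_int (2 * n - 1 - b)"
    proof
      assume "of_int n * phi = of_int (2 * n - 1 - b)"
      then have "of_int (- (2 * n - 1 - b)) + of_int n * phi = 0" by simp
      then have "n = 0" by (rule phi_lin_indep)
      then show False using R by simp
    qed
    then have y: "-1 < y" "y < phi"
      unfolding lower upper using le by (auto simp: algebra_simps)
    have "0 < of_int n * (2 - phi)" using R phi_bounds by simp
    then have "0 < of_int b + (1::real)" using y upper by simp
    then have b: "0 \<le> b" by linarith
    have "0 \<le> x"
    proof (cases "b = 0")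
      case True
      then show ?thesis using R by (simp add: xy n_def)
    next
      case False
      then have "1 * (phi - psi) \<le> x - y"
        unfolding diff using b phi_bounds psi_bounds by (intro mult_right_mono) auto
      then show ?thesis using y phi_bounds psi_bounds by simp
    qed
    then show "phi_integer x y" using y unfolding phi_integer_def conj_pair_def xy by blast
  qed
qed

text \<open>A ring element and its conjugate have an integer sum, computed here by Binet's formula;
  the ceiling of the one is this sum minus the floor of the other.\<close>

lemma ceiling_phi_integer:
  assumes t: "p + p' = of_int t"
  shows "\<lceil>phi ^ e * (of_int a + of_int b * phi) + p\<rceil> =
    a * lucas e + b * lucas (Suc e) + t - \<lfloor>p' + psi ^ e * (of_int a + of_int b * psi)\<rfloor>"
proof -
  have "phi ^ e * (of_int a + of_int b * phi) + p =
      of_int (a * lucas e + b * lucas (Suc e) + t) - (p' + psi ^ e * (of_int a + of_int b * psi))"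
    using t[symmetric] by (simp add: lucas_eq algebra_simps)
  moreover have "\<lceil>of_int k - r\<rceil> = k - \<lfloor>r\<rfloor>" for k and r :: real
    by (simp add: ceiling_def)
  ultimately show ?thesis by metis
qed

text \<open>With \<open>n = k + 1\<close>, the values
  \<open>b = 2 * n - 1 - \<lfloor>n * phi\<rfloor>\<close> and \<open>a = n - 1 - 2 * b\<close> are
  substituted into the preceding formula, and the Lucas recurrence collapses the
  coefficients.\<close>

lemma ceiling_phi_integers_eq_V:
  assumes t: "p + p' = of_int t"
    and g: "\<And>y. -1 < y \<Longrightarrow> y < phi \<Longrightarrow> \<lfloor>p' + psi ^ (i + 3) * y\<rfloor> = g"
  shows "{\<lceil>phi ^ (i + 3) * x + p\<rceil> | x y. phi_integer x y} =
    range (V (lucas (i + 1)) (lucas i) (t - lucas (i + 2) - g))"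
    (is "?A = range ?v")
proof -
  have val: "\<lceil>phi ^ (i + 3) * (of_int a + of_int b * phi) + p\<rceil> = ?v k"
    if P: "phi_integer (of_int a + of_int b * phi) (of_int a + of_int b * psi)"
      and k: "a + 2 * b = int k" for a b k
  proof -
    have f: "\<lfloor>of_int (1 + int k) * phi\<rfloor> = 2 * (int k + 1) - 1 - b"
      using P k unfolding phi_integer_iff by (simp add: add.commute)
    have "\<lceil>phi ^ (i + 3) * (of_int a + of_int b * phi) + p\<rceil> =
        a * lucas (i + 3) + b * lucas (Suc (i + 3)) + t - g"
      using P g by (simp add: ceiling_phi_integer[OF t] phi_integer_def)
    also have "\<dots> = ?v k"
    proof -
      have L: "lucas (i + 2) = lucas (i + 1) + lucas i"
        "lucas (i + 3) = 2 * lucas (i + 1) + lucas i"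
        "lucas (Suc (i + 3)) = 3 * lucas (i + 1) + 2 * lucas i"
        by (simp_all add: numeral_eq_Suc)
      have a: "a = int k - 2 * b" using k by simp
      have "?v k = lucas (i + 1) * (2 * (int k + 1) - 1 - b) + lucas i * (int k + 1)
          + (t - lucas (i + 2) - g)"
        using f by (simp add: V_def beatty_term_def add.commute)
      then show ?thesis unfolding L a by (simp add: algebra_simps)
    qed
    finally show ?thesis .
  qed
  show ?thesis
  proof (intro subset_antisym subsetI)
    fix z assume "z \<in> ?A"
    then obtain x y where z: "z = \<lceil>phi ^ (i + 3) * x + p\<rceil>" and xy: "phi_integer x y" by blast
    obtain a b where ab: "x = of_int a + of_int b * phi" "y = of_int a + of_int b * psi"
      using xy by (auto simp: phi_integer_def elim: conj_pairE)
    have P: "phi_integer (of_int a + of_int b * phi) (of_int a + of_int b * psi)"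
      using xy ab by simp
    then have "0 \<le> a + 2 * b" unfolding phi_integer_iff by simp
    then show "z \<in> range ?v" using val[OF P, of "nat (a + 2 * b)"] z ab by auto
  next
    fix z assume "z \<in> range ?v"
    then obtain k where z: "z = ?v k" by blast
    \<comment> \<open>The formula for \<open>b\<close>, now read as a definition, produces the
      phi-integer of index \<open>k + 1\<close>.\<close>
    define b where "b = 2 * (int k + 1) - 1 - \<lfloor>of_int (int k + 1) * phi\<rfloor>"
    define a where "a = int k - 2 * b"
    have ab: "a + 2 * b = int k" "a + 2 * b + 1 = int k + 1" by (simp_all add: a_def)
    have P: "phi_integer (of_int a + of_int b * phi) (of_int a + of_int b * psi)"
      unfolding phi_integer_iff ab(2) by (simp add: b_def)
    show "z \<in> ?A" unfolding z val[OF P ab(1), symmetric] using P by blast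
  qed
qed

text \<open>As \<open>y\<close> tends to \<open>phi\<close>, the term \<open>- psi\<^sup>e\<^sup>+\<^sup>1 y\<close> tends to \<open>psi\<^sup>e\<close>, so \<open>p - psi\<^sup>e\<^sup>+\<^sup>1 y\<close>
  drops below \<open>phi\<^sup>e + psi\<^sup>e\<close>, which is a Lucas number; \<open>y = 0\<close> suffices if \<open>psi\<^sup>e \<ge> 0\<close>.\<close>

lemma offset_nonpos:
  assumes t: "p + p' = of_int t" and less: "p < phi ^ e"
    and g: "\<And>y. -1 < y \<Longrightarrow> y < phi \<Longrightarrow> \<lfloor>p' + psi ^ Suc e * y\<rfloor> = g"
  shows "t - lucas e - g \<le> 0"
proof -
  have "\<exists>y. -1 < y \<and> y < phi \<and> p - psi ^ Suc e * y < phi ^ e + psi ^ e"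
  proof (cases "psi ^ e < 0")
    case True
    define s where "s = - (psi ^ e)"
    have s: "0 < s" using True by (simp add: s_def)
    define c where "c = s * (- psi)"
    have c: "0 < c" using s psi_bounds by (simp add: c_def mult_pos_neg)
    \<comment> \<open>Here \<open>c\<close> equals \<open>psi ^ Suc e\<close>. The point
      \<open>y\<close> is to be so close to \<open>phi\<close> that \<open>c * (phi - y)\<close> is
      less than the gap \<open>phi ^ e - p\<close>.\<close>
    have "phi - (phi ^ e - p) / c < phi" using less c by simp
    then obtain y where y: "max 0 (phi - (phi ^ e - p) / c) < y" "y < phi"
      using dense[of "max 0 (phi - (phi ^ e - p) / c)" phi] phi_bounds by auto
    then have "phi - y < (phi ^ e - p) / c" by simp
    then have "(phi - y) * (s * (- psi)) < phi ^ e - p"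
      unfolding c_def[symmetric] using c by (simp only: pos_less_divide_eq)
    moreover have "(phi - y) * (s * (- psi)) = s - psi ^ Suc e * y"
    proof -
      have "(phi - y) * (s * (- psi)) = - s * (phi * psi) + s * psi * y"
        by (simp add: algebra_simps)
      then show ?thesis unfolding phi_mult_psi by (simp add: s_def)
    qed
    ultimately show ?thesis using y by (intro exI[of _ y]) (auto simp: s_def)
  next
    case False
    then have "p < phi ^ e + psi ^ e" using less by linarith
    then show ?thesis using phi_bounds by (intro exI[of _ 0]) (simp del: power_less_zero_eq)
  qed
  then obtain y where y: "-1 < y" "y < phi" "p - psi ^ Suc e * y < of_int (lucas e)"
    by (auto simp: lucas_eq)
  then have "of_int (t - lucas e) < p' + psi ^ Suc e * y" using t by simp
  then have "t - lucas e \<le> \<lfloor>p' + psi ^ Suc e * y\<rfloor>" by (simp add: le_floor_iff)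
  then show ?thesis using g y by simp
qed

text \<open>Since \<open>phi * psi = -1\<close>, the factor maps the interval from 0 to
  \<open>phi\<close> into (0, 1) or (-1, 0), according to the parity of \<open>n\<close>.\<close>

lemma floor_psi_power_mult:
  assumes "1 \<le> n" "0 < z" "z < phi"
  shows "\<lfloor>psi ^ n * z\<rfloor> = - of_bool (odd n)"
proof -
  define c where "c = (- psi) ^ n"
  have c: "0 < c" using psi_bounds by (simp add: c_def)
  have "c \<le> (- psi) ^ 1"
    unfolding c_def using assms(1) psi_bounds by (intro power_decreasing) auto
  then have "c * phi \<le> 1"
    using mult_right_mono[of c "- psi" phi] phi_bounds phi_mult_psi by (simp add: mult.commute)
  moreover have "c * z < c * phi" using assms c by simp
  ultimately have "c * z < 1" by simp
  moreover have "0 < c * z" using assms c by simp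
  moreover have "psi ^ n = (if even n then c else - c)" by (simp add: c_def)
  ultimately show ?thesis by (auto intro!: floor_unique)
qed

text \<open>With \<open>j\<close> the least element of \<open>Q\<close>, the sum is
  \<open>psi ^ nat j\<close> times a number between \<open>- psi\<close> and \<open>phi\<close>, so
  only the parity of \<open>j\<close> matters.\<close>

lemma floor_expansion_psi_tail:
  assumes "sparse Q" "Q \<subseteq> {1..int e - 2}" "Q \<noteq> {}"
  obtains g where "\<And>y. -1 < y \<Longrightarrow> y < phi \<Longrightarrow> \<lfloor>expansion psi Q + psi ^ e * y\<rfloor> = g"
proof -
  define j where "j = Min Q"
  have fin: "finite Q" using assms(1) by (rule sparse_finite)
  have j: "j \<in> Q" using fin assms(3) by (simp add: j_def)
  then have j1: "1 \<le> j" "j + 2 \<le> int e" using assms(2) by auto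
  have sub: "Q - {j} \<subseteq> {j + 2..int e - 2}"
  proof
    fix i assume i: "i \<in> Q - {j}"
    have "j \<le> i" using i fin by (simp add: j_def)
    moreover have "i \<noteq> j + 1" using i j assms(1) by (auto simp: sparse_def)
    ultimately show "i \<in> {j + 2..int e - 2}" using i assms(2) by force
  qed
  have "\<lfloor>expansion psi Q + psi ^ e * y\<rfloor> = - of_bool (odd (nat j))"
    if y: "-1 < y" "y < phi" for y
  proof -
    have "sparse (Q - {j})" using assms(1) by (rule sparse_subset) auto
    then obtain z where z: "-1 < z" "z < phi"
      "expansion psi (Q - {j}) + psi powi (int e) * y = psi powi (j + 2) * z"
      using expansion_psi_window[OF _ sub j1(2) y] by blast
    then have "expansion psi Q + psi ^ e * y = psi powi j * (1 + psi * (psi * z))"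
      using expansion_remove[OF fin j, of psi] psi_neq_0
      by (simp add: power_int_add power2_eq_square algebra_simps)
    also have "psi powi j = psi ^ nat j" using j1 by (simp add: power_int_def)
    finally show ?thesis
      using one_plus_psi_sq_mult_window[OF z(1,2)] psi_bounds j1
      by (simp add: floor_psi_power_mult)
  qed
  then show thesis by (rule that)
qed

lemma strict_mono_V:
  assumes "0 < p" "0 < q"
  shows "strict_mono (V p q r)"
proof (rule strict_monoI)
  fix m n :: nat assume "m < n"
  then have "\<lfloor>real (m + 1) * phi\<rfloor> \<le> \<lfloor>real (n + 1) * phi\<rfloor>"
    using phi_bounds by (intro floor_mono mult_right_mono) auto
  then have "p * \<lfloor>real (m + 1) * phi\<rfloor> \<le> p * \<lfloor>real (n + 1) * phi\<rfloor>"
    using assms by (intro mult_left_mono) auto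
  moreover have "q * int (m + 1) < q * int (n + 1)"
    using assms \<open>m < n\<close> by (intro mult_strict_left_mono) auto
  ultimately show "V p q r m < V p q r n" by (simp add: V_def beatty_term_def)
qed

lemma with_low_digits_eq_V:
  assumes "sparse Q" "Q \<subseteq> {1..int i + 1}" "Q \<noteq> {}"
  shows "\<exists>\<gamma>\<le>0. increasing_listing (int ` with_low_digits (i + 3) Q) (V (lucas (i + 1)) (lucas i) \<gamma>)"
proof -
  have sub: "Q \<subseteq> {1..int (i + 3) - 2}" using assms(2) by auto
  obtain g where g: "\<And>y. -1 < y \<Longrightarrow> y < phi \<Longrightarrow> \<lfloor>expansion psi Q + psi ^ (i + 3) * y\<rfloor> = g"
    using floor_expansion_psi_tail[OF assms(1) sub assms(3)] by blast
  obtain t where t: "expansion phi Q + expansion psi Q = of_int t"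
    using conj_pair_expansion by (rule conj_pair_traceE)
  have "int ` with_low_digits (i + 3) Q = range (V (lucas (i + 1)) (lucas i) (t - lucas (i + 2) - g))"
    using with_low_digits_eq[OF _ assms(1) sub] ceiling_phi_integers_eq_V[OF t g] by simp
  moreover have "strict_mono (V (lucas (i + 1)) (lucas i) (t - lucas (i + 2) - g))"
    by (intro strict_mono_V lucas_pos)
  \<comment> \<open>The case \<open>e = i + 2\<close> of \<open>offset_nonpos\<close>: all of
    \<open>Q\<close> lies below \<open>i + 2\<close>, while the tail starts at
    \<open>i + 3\<close>.\<close>
  moreover have "t - lucas (i + 2) - g \<le> 0"
  proof (rule offset_nonpos[OF t])
    have "expansion phi Q < phi powi (int (i + 2))"
      using assms by (intro expansion_phi_less) auto
    then show "expansion phi Q < phi ^ (i + 2)" by (simp only: power_int_of_nat)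
  next
    fix y assume "-1 < y" "y < phi"
    then show "\<lfloor>expansion psi Q + psi ^ Suc (i + 2) * y\<rfloor> = g"
      using g by (simp add: numeral_eq_Suc)
  qed
  ultimately show ?thesis unfolding increasing_listing_def by blast
qed

section \<open>Words of zeros\<close>

text \<open>Converse to the two removals. In \<open>phi * x + 1\<close> adjacent ones may arise, but
  the window is still met because \<open>1 - psi = phi\<close>.\<close>

lemma phi_integer_mult_phi:
  assumes "phi_integer x y"
  shows "phi_integer (phi * x) (psi * y)" "phi_integer (phi * x + 1) (psi * y + 1)"
proof -
  have c: "conj_pair (phi * x) (psi * y)"
    using assms by (auto simp: phi_integer_def intro: conj_pair_mult conj_pair_phi)
  then have "conj_pair (phi * x + 1) (psi * y + 1)"
    using conj_pair_add conj_pair_of_int[of 1] by fastforce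
  moreover have "-1 < psi * y" "psi * y < - psi"
    using assms psi_mult_window[of y] by (auto simp: phi_integer_def)
  moreover have "0 \<le> phi * x" using assms phi_bounds by (simp add: phi_integer_def)
  ultimately show "phi_integer (phi * x) (psi * y)" "phi_integer (phi * x + 1) (psi * y + 1)"
    using c phi_bounds by (auto simp: phi_integer_def psi_def)
qed

lemma phi_integer_0: "phi_integer 0 0"
  using conj_pair_of_int[of 0] phi_bounds by (simp add: phi_integer_def)

text \<open>The sign of the conjugate \<open>y\<close> tells the parity of the position of the lowest nonzero
  digit of \<open>x\<close>.\<close>

lemma phi_integer_cases:
  assumes "phi_integer x y"
  obtains "x = 0"
  | u v where "phi_integer u v" "x = phi * u + 1"
  | u v where "phi_integer u v" "x = phi * (phi * u + 1)"
proof -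
  have cancel: "phi * (- psi * z) = z" for z
    using phi_mult_psi by (simp flip: mult.assoc)
  consider "0 < y" | "y = 0" | "y < 0" by linarith
  then show thesis
  proof cases
    case 1
    show thesis using that(2)[OF phi_integer_shift2[OF assms 1]] cancel[of "x - 1"] by simp
  next
    case 2
    obtain a b where ab: "x = of_int a + of_int b * phi" "y = of_int a + of_int b * psi"
      using assms by (auto simp: phi_integer_def elim: conj_pairE)
    have "of_int (a + b) + of_int (- b) * phi = 0"
      using ab(2) 2 by (simp add: psi_def algebra_simps)
    then have "a + b = 0" "- b = 0" by (rule phi_lin_indep)+
    then show thesis using that(1) ab by simp
  next
    case 3
    \<comment> \<open>A negative conjugate means a last digit 0; its removal makes the conjugate
      positive, so \<open>phi_integer_shift2\<close> applies.\<close>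
    then have "phi_integer (- psi * x) (- phi * y)"
      using assms psi_bounds by (intro phi_integer_shift1) auto
    moreover have "0 < - phi * y" using 3 phi_bounds by (simp add: mult_pos_neg)
    ultimately have "phi_integer (- psi * (- psi * x - 1)) (- phi * (- phi * y - 1))"
      by (rule phi_integer_shift2)
    then show thesis using that(3) cancel[of "- psi * x - 1"] cancel[of x] by simp
  qed
qed

text \<open>Equal ceilings make \<open>x - x'\<close> smaller than \<open>- psi\<close> in absolute
  value. Together with the window for the conjugates this leaves \<open>b\<close> in {-1, 0, 1},
  where only the zero difference survives.\<close>

lemma phi_integer_unique_ceiling:
  assumes "1 \<le> m" "phi_integer x y" "phi_integer x' y'"
    and eq: "\<lceil>phi ^ m * x\<rceil> = \<lceil>phi ^ m * x'\<rceil>"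
  shows "x = x' \<and> y = y'"
proof -
  have "phi \<le> phi ^ m"
    using power_increasing[of 1 m phi] assms(1) phi_bounds by simp
  then have "phi * \<bar>x - x'\<bar> \<le> phi ^ m * \<bar>x - x'\<bar>" by (intro mult_right_mono) auto
  also have "\<dots> = \<bar>phi ^ m * x - phi ^ m * x'\<bar>"
    using phi_bounds by (simp add: abs_mult flip: right_diff_distrib)
  also have "\<dots> < 1" using eq by linarith
  also have "1 = phi * (- psi)" using phi_mult_psi by simp
  finally have small: "\<bar>x - x'\<bar> < - psi" using phi_bounds by (simp only: mult_less_cancel_left_pos)
  have cp: "conj_pair (x - x') (y - y')"
    using assms by (auto simp: phi_integer_def intro: conj_pair_diff)
  then obtain a b where ab: "x - x' = of_int a + of_int b * phi" "y - y' = of_int a + of_int b * psi"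
    by (rule conj_pairE)
  have y: "\<bar>y - y'\<bar> < 1 + phi" using assms by (auto simp: phi_integer_def)
  have "of_int \<bar>b\<bar> * (phi - psi) = \<bar>(x - x') - (y - y')\<bar>"
    unfolding ab using phi_bounds psi_bounds by (simp add: abs_mult flip: right_diff_distrib)
  also have "\<dots> \<le> \<bar>x - x'\<bar> + \<bar>y - y'\<bar>" by (rule abs_triangle_ineq4)
  also have "\<dots> < 2 * (phi - psi)" using y small phi_bounds psi_bounds by simp
  finally have "of_int \<bar>b\<bar> < (2::real)"
    by (rule mult_right_less_imp_less) (use phi_bounds psi_bounds in auto)
  then have "b = 0 \<or> b = 1 \<or> b = -1" by linarith
  then have "b = 0 \<and> a = 0"
  proof (elim disjE)
    assume b: "b = 0"
    then have "\<bar>of_int a\<bar> < (1::real)" using ab small psi_bounds by simp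
    then show ?thesis using b by linarith
  next
    assume "b = 1"
    then have "of_int (a + 1) < (0::real)" "(0::real) < of_int (a + 2)"
      using ab y small by (simp_all add: psi_def abs_less_iff)
    then show ?thesis unfolding of_int_less_0_iff of_int_0_less_iff by simp
  next
    assume "b = -1"
    then have "(0::real) < of_int (a - 1)" "of_int (a - 2) < (0::real)"
      using ab y small by (simp_all add: psi_def abs_less_iff)
    then show ?thesis unfolding of_int_less_0_iff of_int_0_less_iff by simp
  qed
  then show ?thesis using ab by simp
qed

text \<open>Here \<open>p\<close> is the power directly below the tail. Its trace
  \<open>lucas (i + 2)\<close> cancels in the offset, which leaves only minus the constant
  floor.\<close>

lemma ceiling_phi_integers_single_digit:
  "{\<lceil>phi ^ (i + 3) * x + phi ^ (i + 2)\<rceil> | x y. phi_integer x y} =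
    range (V (lucas (i + 1)) (lucas i) (of_bool (odd i)))"
proof -
  have g: "\<lfloor>psi ^ (i + 2) + psi ^ (i + 3) * y\<rfloor> = - of_bool (odd i)"
    if "-1 < y" "y < phi" for y
  proof -
    have "0 < 1 + psi * y" "1 + psi * y < phi"
      using psi_mult_window[OF that] by (auto simp: psi_def)
    then have "\<lfloor>psi ^ (i + 2) * (1 + psi * y)\<rfloor> = - of_bool (odd (i + 2))"
      by (intro floor_psi_power_mult) auto
    moreover have "psi ^ (i + 2) * (1 + psi * y) = psi ^ (i + 2) + psi ^ (i + 3) * y"
      by (simp add: algebra_simps numeral_eq_Suc)
    ultimately show ?thesis by simp
  qed
  have "phi ^ (i + 2) + psi ^ (i + 2) = of_int (lucas (i + 2))"
    by (rule lucas_eq[symmetric])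
  from ceiling_phi_integers_eq_V[OF this g] show ?thesis by simp
qed

text \<open>A nonzero phi-integer is \<open>phi * u + 1\<close> or
  \<open>phi * (phi * u + 1)\<close> for a phi-integer \<open>u\<close>. Multiplied by
  \<open>phi ^ (i + 2)\<close>, these forms fall under the preceding lemma for \<open>i\<close> and
  for \<open>i + 1\<close>.\<close>

lemma occurrences_zeros:
  fixes i :: nat
  defines "A \<equiv> \<lambda>i. range (V (lucas (i + 1)) (lucas i) (of_bool (odd i)))"
  shows "int ` occurrences (replicate (i + 2) 0) = insert 0 (A i \<union> A (i + 1))"
    and "0 \<notin> A i \<union> A (i + 1)"
    and "A i \<inter> A (i + 1) = {}"
proof -
  define c where "c x = \<lceil>phi ^ (i + 2) * x\<rceil>" for x
  have "ones (replicate (i + 2) 0) = {}" by (auto simp: ones_def simp del: replicate_Suc)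
  then have occ: "int ` occurrences (replicate (i + 2) 0) = {c x | x y. phi_integer x y}"
    using occurrences_eq[of "replicate (i + 2) 0"] with_low_digits_eq[of "i + 2" "{}"]
    by (simp add: sparse_def expansion_def c_def del: replicate_Suc)
  have A0: "A i = {c (phi * x + 1) | x y. phi_integer x y}"
  proof -
    have "phi ^ (i + 2) * (phi * x + 1) = phi ^ (i + 3) * x + phi ^ (i + 2)" for x
      by (simp add: algebra_simps numeral_eq_Suc)
    then show ?thesis
      unfolding A_def c_def ceiling_phi_integers_single_digit[symmetric] by (simp only:)
  qed
  have A1: "A (i + 1) = {c (phi * (phi * x + 1)) | x y. phi_integer x y}"
  proof -
    have "phi ^ (i + 2) * (phi * (phi * x + 1)) = phi ^ (i + 1 + 3) * x + phi ^ (i + 1 + 2)" for x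
      by (simp add: algebra_simps numeral_eq_Suc)
    then show ?thesis
      unfolding A_def c_def ceiling_phi_integers_single_digit[symmetric] by (simp only:)
  qed
  have c0: "c 0 = 0" by (simp add: c_def)
  have "{c x | x y. phi_integer x y} \<subseteq> insert 0 (A i \<union> A (i + 1))"
  proof
    fix z assume "z \<in> {c x | x y. phi_integer x y}"
    then obtain x y where "z = c x" "phi_integer x y" by auto
    from \<open>phi_integer x y\<close> show "z \<in> insert 0 (A i \<union> A (i + 1))"
    proof (cases rule: phi_integer_cases)
      case 1
      then show ?thesis using \<open>z = c x\<close> c0 by simp
    next
      case 2
      then show ?thesis using \<open>z = c x\<close> unfolding A0 by blast
    next
      case 3
      then show ?thesis using \<open>z = c x\<close> unfolding A1 by blast
    qed
  qed
  moreover have "insert 0 (A i \<union> A (i + 1)) \<subseteq> {c x | x y. phi_integer x y}"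
  proof (intro insert_subsetI Un_least)
    show "0 \<in> {c x | x y. phi_integer x y}" using c0 phi_integer_0 by force
    show "A i \<subseteq> {c x | x y. phi_integer x y}"
      unfolding A0 using phi_integer_mult_phi(2) by blast
    show "A (i + 1) \<subseteq> {c x | x y. phi_integer x y}"
      unfolding A1 using phi_integer_mult_phi by blast
  qed
  ultimately show "int ` occurrences (replicate (i + 2) 0) = insert 0 (A i \<union> A (i + 1))"
    unfolding occ by (rule subset_antisym)
  have unique: "x = x' \<and> y = y'" if "phi_integer x y" "phi_integer x' y'" "c x = c x'" for x y x' y'
    using phi_integer_unique_ceiling[of "i + 2" x y x' y'] that by (simp add: c_def)
  \<comment> \<open>The two families have conjugates of opposite sign and 0 has conjugate 0, so
    injectivity of the ceiling separates all three.\<close>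
  have pos: "phi_integer (phi * x + 1) (psi * y + 1)" "0 < psi * y + 1" if "phi_integer x y" for x y
    using that phi_integer_mult_phi psi_mult_window[of y] by (auto simp: phi_integer_def)
  have neg: "phi_integer (phi * (phi * x + 1)) (psi * (psi * y + 1))" "psi * (psi * y + 1) < 0"
    if "phi_integer x y" for x y
    using pos[OF that] psi_bounds by (auto simp: mult_neg_pos intro: phi_integer_mult_phi)
  show "0 \<notin> A i \<union> A (i + 1)"
  proof
    assume "0 \<in> A i \<union> A (i + 1)"
    then consider x y where "phi_integer x y" "c (phi * x + 1) = c 0"
      | x y where "phi_integer x y" "c (phi * (phi * x + 1)) = c 0"
      unfolding A0 A1 c0 by fastforce
    then show False
    proof cases
      case 1
      then show False using unique[OF pos(1) phi_integer_0] pos(2) by fastforce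
    next
      case 2
      then show False using unique[OF neg(1) phi_integer_0] neg(2) by fastforce
    qed
  qed
  show "A i \<inter> A (i + 1) = {}"
  proof (rule ccontr)
    assume "A i \<inter> A (i + 1) \<noteq> {}"
    then obtain x y x' y' where xy: "phi_integer x y" "phi_integer x' y'"
      "c (phi * x + 1) = c (phi * (phi * x' + 1))"
      unfolding A0 A1 by auto
    then show False using unique[OF pos(1)[OF xy(1)] neg(1)[OF xy(2)]] pos(2) neg(2) by force
  qed
qed

lemma increasing_listing_exists:
  assumes "infinite A"
  obtains s where "increasing_listing (int ` A) s"
proof
  show "increasing_listing (int ` A) (\<lambda>n. int (enumerate A n))"
    unfolding increasing_listing_def
    using strict_mono_enumerate[OF assms] range_enumerate[OF assms] image_image[of int "enumerate A" UNIV]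
    by (simp add: strict_mono_def)
qed

text \<open>The extra term at \<open>n = 0\<close> is \<open>r\<close>; with \<open>r = 0\<close> it
  supplies the number 0 in the formulas for zero words.\<close>

lemma range_V0: "range (V0 p q r) = insert r (range (V p q r))"
proof -
  have "(UNIV :: nat set) = insert 0 (range Suc)" using not0_implies_Suc by auto
  then have "range (V0 p q r) = insert (V0 p q r 0) (V0 p q r ` range Suc)" by (metis image_insert)
  then show ?thesis by (simp add: image_image V_def V0_def beatty_term_def)
qed

lemma is_R_zeros:
  fixes i :: nat
  obtains R where "is_R (replicate (i + 2) 0) R"
proof -
  have "infinite (range (V (lucas (i + 1)) (lucas i) (of_bool (odd i))))"
    by (intro range_inj_infinite strict_mono_imp_inj_on strict_mono_V lucas_pos)
  then have "infinite (int ` occurrences (replicate (i + 2) 0))"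
    unfolding occurrences_zeros(1) by simp
  then have "infinite (occurrences (replicate (i + 2) 0))" by blast
  then show thesis using increasing_listing_exists that unfolding is_R_def by blast
qed

section \<open>Nonzero words\<close>

lemma ones_neq_empty:
  assumes "set w \<subseteq> {0, 1}" "w \<noteq> replicate (length w) 0"
  shows "ones w \<noteq> {}"
proof -
  obtain x where "x \<in> set w" "x \<noteq> 0"
    using assms(2) replicate_eqI[of w "length w" 0] by auto
  then have "1 \<in> set (rev w)" using assms(1) by auto
  then obtain j where "j < length w" "rev w ! j = 1"
    unfolding in_set_conv_nth length_rev by blast
  then show ?thesis unfolding ones_def by blast
qed

lemma mem_ones_iff: "j \<in> ones w \<longleftrightarrow> 0 \<le> j \<and> j < int (length w) \<and> rev w ! nat j = 1"
  by (auto simp: ones_def image_iff intro!: exI[of _ "nat j"])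

text \<open>Ones at adjacent positions give a factor 11 of the reversed word, and 11 is its own
  reversal.\<close>

lemma sparse_ones:
  assumes "\<not> sublist [1, 1] w"
  shows "sparse (ones w)"
  unfolding sparse_def
proof (intro conjI ballI notI)
  show "finite (ones w)" by (simp add: ones_def)
  fix i assume "i \<in> ones w" "i + 1 \<in> ones w"
  then obtain j where j: "Suc j < length w" "rev w ! j = 1" "rev w ! Suc j = 1"
    unfolding mem_ones_iff by (metis (full_types) Suc_nat_eq_nat_zadd1 add.commute nat_less_iff)
  have "rev w = take j (rev w) @ [1, 1] @ drop (Suc (Suc j)) (rev w)"
    using j Cons_nth_drop_Suc[of j "rev w"] Cons_nth_drop_Suc[of "Suc j" "rev w"]
      append_take_drop_id[of j "rev w"] by simp
  then have "sublist [1, 1] (rev w)" unfolding sublist_def by blast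
  then have "sublist (rev [1, 1]) w" by (simp only: sublist_rev_left)
  then show False using assms by simp
qed

lemma is_R_nonzero_word:
  assumes len: "2 \<le> m" "length w = m" and w: "set w \<subseteq> {0, 1}" "\<not> sublist [1, 1] w"
    and last: "last w = 0" and nz: "w \<noteq> replicate m 0"
  shows "\<exists>\<gamma>\<le>0. (hd w = 0 \<longrightarrow> is_R w (V (lucas (m - 2)) (lucas (m - 3)) \<gamma>)) \<and>
    (hd w = 1 \<longrightarrow> is_R w (V (lucas (m - 1)) (lucas (m - 2)) \<gamma>))"
proof -
  define Q where "Q = ones w"
  have occ: "occurrences w = with_low_digits m Q"
    using occurrences_eq[OF w(1)] len by (simp add: Q_def)
  have sp: "sparse Q" unfolding Q_def using w(2) by (rule sparse_ones)
  have ne: "w \<noteq> []" using len by auto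
  have "Q \<noteq> {}" using ones_neq_empty[OF w(1)] nz len by (simp add: Q_def)
  have "rev w ! 0 = last w" using ne by (simp flip: hd_rev add: hd_conv_nth)
  then have "0 \<notin> Q" using last by (simp add: Q_def mem_ones_iff)
  then have sub: "Q \<subseteq> {1..int m - 1}"
  proof (intro subsetI)
    fix j assume "j \<in> Q"
    moreover from this have "j \<noteq> 0" using \<open>0 \<notin> Q\<close> by auto
    ultimately show "j \<in> {1..int m - 1}" using len by (simp add: Q_def mem_ones_iff)
  qed
  have "rev w ! (m - 1) = hd w"
    using ne len by (simp add: rev_nth hd_conv_nth)
  then have top: "int m - 1 \<in> Q \<longleftrightarrow> hd w = 1"
    using len by (simp add: Q_def mem_ones_iff nat_diff_distrib)
  have "hd w = 0 \<or> hd w = 1" using w(1) ne hd_in_set by blast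
  then show ?thesis
  proof
    assume hd: "hd w = 0"
    then have "int m - 1 \<notin> Q" using top by simp
    have sub2: "Q \<subseteq> {1..int m - 2}"
    proof
      fix j assume "j \<in> Q"
      moreover from this have "j \<noteq> int m - 1" using \<open>int m - 1 \<notin> Q\<close> by auto
      ultimately show "j \<in> {1..int m - 2}" using sub by force
    qed
    \<comment> \<open>For \<open>m = 2\<close> no position would be left for a one; hence
      \<open>m - 3\<close> is not truncated.\<close>
    then have "3 \<le> m" using \<open>Q \<noteq> {}\<close> by fastforce
    then obtain i where i: "m = i + 3" by (metis add.commute le_Suc_ex)
    show ?thesis
      using with_low_digits_eq_V[OF sp _ \<open>Q \<noteq> {}\<close>, of i] sub2 hd
      by (simp add: is_R_def occ i add.commute)
  next
    assume hd: "hd w = 1"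
    obtain i where i: "m = i + 2" using len(1) by (metis add.commute le_Suc_ex)
    \<comment> \<open>A one at \<open>m - 1\<close> forces a zero at \<open>m\<close>, so
      \<open>Q\<close> also describes a word of length \<open>m + 1\<close> with leading digit 0;
      this raises the Lucas indices by one.\<close>
    have "D \<inter> {0..<int m} = Q \<longleftrightarrow> D \<inter> {0..<int (i + 3)} = Q" if "sparse D" for D
    proof -
      have "{0..<int (i + 3)} = insert (int m) {0..<int m}" by (auto simp: i)
      moreover have "int m \<notin> D" if "int m - 1 \<in> D"
        using \<open>sparse D\<close> that by (force simp: sparse_def)
      moreover have "int m \<notin> Q" "int m - 1 \<in> Q" using sub top hd by auto
      ultimately show ?thesis by auto
    qed
    then have "with_low_digits m Q = with_low_digits (i + 3) Q"
      unfolding with_low_digits_def by blast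
    then show ?thesis
      using with_low_digits_eq_V[OF sp _ \<open>Q \<noteq> {}\<close>, of i] sub hd
      by (simp add: is_R_def occ i add.commute)
  qed
qed

theorem theorem6p3:
  "(\<forall>(m::nat) (w::nat list).
      m \<ge> 2 \<and> length w = m \<and> set w \<subseteq> {0, 1} \<and> \<not> sublist [1, 1] w \<and>
      last w = 0 \<and> w \<noteq> replicate m 0 \<longrightarrow>
      (\<exists>\<gamma>::int. \<gamma> \<le> 0 \<and>
         (hd w = 0 \<longrightarrow> is_R w (V (lucas (m - 2)) (lucas (m - 3)) \<gamma>)) \<and>
         (hd w = 1 \<longrightarrow> is_R w (V (lucas (m - 1)) (lucas (m - 2)) \<gamma>)))) \<and>
   (\<forall>m::nat. m \<ge> 1 \<longrightarrow>
      (\<exists>R. is_R (replicate (2 * m) 0) R \<and>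
           is_disjoint_union (V (lucas (2 * m)) (lucas (2 * m - 1)) 1)
             (V0 (lucas (2 * m - 1)) (lucas (2 * m - 2)) 0) R) \<and>
      (\<exists>R. is_R (replicate (2 * m + 1) 0) R \<and>
           is_disjoint_union (V0 (lucas (2 * m + 1)) (lucas (2 * m)) 0)
             (V (lucas (2 * m)) (lucas (2 * m - 1)) 1) R))"
proof (intro conjI allI impI)
  fix m w
  assume "m \<ge> 2 \<and> length w = m \<and> set w \<subseteq> {0, 1} \<and> \<not> sublist [1, 1] w \<and>
      last w = 0 \<and> w \<noteq> replicate m (0::nat)"
  then show "\<exists>\<gamma>::int. \<gamma> \<le> 0 \<and>
         (hd w = 0 \<longrightarrow> is_R w (V (lucas (m - 2)) (lucas (m - 3)) \<gamma>)) \<and>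
         (hd w = 1 \<longrightarrow> is_R w (V (lucas (m - 1)) (lucas (m - 2)) \<gamma>))"
    using is_R_nonzero_word[of m w] by auto
next
  fix m :: nat assume "1 \<le> m"
  \<comment> \<open>Length \<open>2 * m\<close> belongs to the even index \<open>i\<close>, where
    the two families have offsets 0 and 1 in this order; for \<open>i + 1\<close> the order is
    reversed.\<close>
  define i where "i = 2 * m - 2"
  have i: "2 * m = i + 1 + 1" "2 * m - 1 = i + 1" "2 * m - 2 = i" "even i"
    using \<open>1 \<le> m\<close> by (auto simp: i_def)
  have len: "i + 2 = 2 * m" "i + 1 + 2 = 2 * m + 1" using i(1) by simp_all
  have parity: "of_bool (odd i) = (0::int)" "of_bool (odd (i + 1)) = (1::int)"
    "of_bool (odd (i + 1 + 1)) = (0::int)" using i(4) by simp_all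
  note even = occurrences_zeros[of i, unfolded parity len]
  note odd = occurrences_zeros[of "i + 1", unfolded parity len]
  \<comment> \<open>\<open>Y\<close> stands for the family with offset 0, which absorbs the number 0
    as the first term of \<open>V0\<close>.\<close>
  have disjoint: "X \<inter> insert 0 Y = {}" "insert 0 (Y \<union> X) = X \<union> insert 0 Y"
    if "0 \<notin> Y \<union> X" "Y \<inter> X = {}" for X Y :: "int set"
    using that by blast+
  obtain R where R: "is_R (replicate (2 * m) 0) R"
    using is_R_zeros[of i] unfolding len by blast
  then have "is_disjoint_union (V (lucas (2 * m)) (lucas (2 * m - 1)) 1)
      (V0 (lucas (2 * m - 1)) (lucas (2 * m - 2)) 0) R"
    using disjoint[OF even(2,3)]
    unfolding is_disjoint_union_def is_R_def range_V0 even(1) i(2,3) i(1)[symmetric]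
    by simp
  with R show "\<exists>R. is_R (replicate (2 * m) 0) R \<and>
      is_disjoint_union (V (lucas (2 * m)) (lucas (2 * m - 1)) 1)
        (V0 (lucas (2 * m - 1)) (lucas (2 * m - 2)) 0) R"
    by blast
  obtain S where S: "is_R (replicate (2 * m + 1) 0) S"
    using is_R_zeros[of "i + 1"] unfolding len by blast
  have swap: "0 \<notin> X \<union> Y \<Longrightarrow> 0 \<notin> Y \<union> X" "X \<inter> Y = {} \<Longrightarrow> Y \<inter> X = {}" for X Y :: "int set"
    by blast+
  have "is_disjoint_union (V0 (lucas (2 * m + 1)) (lucas (2 * m)) 0)
      (V (lucas (2 * m)) (lucas (2 * m - 1)) 1) S"
    using disjoint[OF swap(1)[OF odd(2)] swap(2)[OF odd(3)]] S
    unfolding is_disjoint_union_def is_R_def range_V0 odd(1) i(2) i(1)[symmetric]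
    by (simp add: Int_commute Un_commute)
  with S show "\<exists>R. is_R (replicate (2 * m + 1) 0) R \<and>
      is_disjoint_union (V0 (lucas (2 * m + 1)) (lucas (2 * m)) 0)
        (V (lucas (2 * m)) (lucas (2 * m - 1)) 1) R"
    by blast
qed

end
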